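(* Let $p$ be an odd prime with $p\equiv 3\pmod 4$. For all integers $A\geq C\geq 1$ and $B\geq D\geq 1$, $$\mathcal R(A,B;C,D)\in\mathbb Z_p[i].$$
   Context: For integers $A\geq C\geq 1$ and $B\geq D\geq 1$, the rectangular Gaussian binomial coefficient is the element of $\mathbb Q(i)$ $$\mathcal R(A,B;C,D):=\frac{\prod_{n=0}^{C-1}\prod_{m=0}^{D-1}\bigl(A+Bi-(n+mi)\bigr)}{\prod_{n=1}^{C}\prod_{m=1}^{D}(n+mi)}=\frac{\prod_{x=A-C+1}^{A}\prod_{y=B-D+1}^{B}(x+iy)}{\prod_{x=1}^{C}\prod_{y=1}^{D}(x+iy)}.$$ For a prime $p\equiv 3\pmod 4$, $\mathbb Q(i)$ is viewed inside $\mathbb Q_p(i)$, the unramified quadratic extension of $\mathbb Q_p$, whose ring of integers is $\mathbb Z_p[i]$. *)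

theory Defs
  imports Complex_Main "HOL-Computational_Algebra.Primes" "HOL-Number_Theory.Cong"
    "HOL-Algebra.QuotRing"
begin

section \<open>Rectangular Gaussian binomial coefficients\<close>

definition gaussian_rationals :: "complex set"
  where "gaussian_rationals = {z. Re z \<in> \<rat> \<and> Im z \<in> \<rat>}"

definition rect_gauss_binomial :: "int \<Rightarrow> int \<Rightarrow> int \<Rightarrow> int \<Rightarrow> complex"
  where "rect_gauss_binomial A B C D =
    (\<Prod>n = 0..C - 1. \<Prod>m = 0..D - 1.
        (of_int A + of_int B * \<i>) - (of_int n + of_int m * \<i>)) /
    (\<Prod>n = 1..C. \<Prod>m = 1..D. of_int n + of_int m * \<i>)"

lemma rect_gauss_binomial_alt:
  "rect_gauss_binomial A B C D =
    (\<Prod>x = A - C + 1..A. \<Prod>y = B - D + 1..B. of_int x + \<i> * of_int y) /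
    (\<Prod>x = 1..C. \<Prod>y = 1..D. of_int x + \<i> * of_int y)"
proof -
  have inner: "(\<Prod>m = 0..D - 1. (of_int A + of_int B * \<i>) - (of_int n + of_int m * \<i>)) =
      (\<Prod>y = B - D + 1..B. of_int (A - n) + \<i> * of_int y)" for n
    by (rule prod.reindex_bij_witness[where i = "\<lambda>y. B - y" and j = "\<lambda>m. B - m"])
      (auto simp: algebra_simps)
  have "(\<Prod>n = 0..C - 1. \<Prod>y = B - D + 1..B. of_int (A - n) + \<i> * of_int y) =
      (\<Prod>x = A - C + 1..A. \<Prod>y = B - D + 1..B. of_int x + \<i> * of_int y)"
    by (rule prod.reindex_bij_witness[where i = "\<lambda>x. A - x" and j = "\<lambda>n. A - n"]) auto
  then show ?thesis
    unfolding rect_gauss_binomial_def inner by (simp add: mult.commute)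
qed

lemma gaussian_rationals_mult:
  "x \<in> gaussian_rationals \<Longrightarrow> y \<in> gaussian_rationals \<Longrightarrow> x * y \<in> gaussian_rationals"
  by (simp add: gaussian_rationals_def)

lemma gaussian_rationals_prod:
  "(\<And>x. x \<in> S \<Longrightarrow> f x \<in> gaussian_rationals) \<Longrightarrow> prod f S \<in> gaussian_rationals"
proof (induction S rule: infinite_finite_induct)
  case (insert x F)
  then show ?case by (simp add: gaussian_rationals_mult)
qed (simp_all add: gaussian_rationals_def)

lemma gaussian_rationals_divide:
  "x \<in> gaussian_rationals \<Longrightarrow> y \<in> gaussian_rationals \<Longrightarrow> x / y \<in> gaussian_rationals"
  by (simp add: gaussian_rationals_def Re_divide Im_divide power2_eq_square)

lemma rect_gauss_binomial_in_gaussian_rationals: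
  "rect_gauss_binomial A B C D \<in> gaussian_rationals"
  unfolding rect_gauss_binomial_def
  by (intro gaussian_rationals_divide gaussian_rationals_prod) (simp_all add: gaussian_rationals_def)


section \<open>The \<open>p\<close>-adic absolute value on the rationals\<close>

definition padic_val :: "nat \<Rightarrow> rat \<Rightarrow> int"
  where "padic_val p x =
    (case quotient_of x of (a, b) \<Rightarrow> int (multiplicity (int p) a) - int (multiplicity (int p) b))"

definition padic_abs :: "nat \<Rightarrow> rat \<Rightarrow> real"
  where "padic_abs p x = (if x = 0 then 0 else real p powi (- padic_val p x))"

lemma padic_val_Fract:
  assumes p: "prime p" and "a \<noteq> 0" "b \<noteq> 0"
  shows "padic_val p (Fract a b) = int (multiplicity (int p) a) - int (multiplicity (int p) b)"
proof -
  obtain c d where q: "quotient_of (Fract a b) = (c, d)" by force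
  have d: "d > 0" using quotient_of_denom_pos[OF q] .
  have "Fract c d = Fract a b" using quotient_of_eq[OF q] .
  then have eq: "c * b = a * d" using assms d by (simp add: eq_rat)
  then have c: "c \<noteq> 0" using assms d by auto
  have pe: "prime_elem (int p)" using p by simp
  have "multiplicity (int p) c + multiplicity (int p) b = multiplicity (int p) a + multiplicity (int p) d"
    using prime_elem_multiplicity_mult_distrib[OF pe] eq c d assms by (metis less_irrefl)
  then show ?thesis unfolding padic_val_def q by simp
qed

lemma padic_abs_0 [simp]: "padic_abs p 0 = 0"
  by (simp add: padic_abs_def)

lemma padic_abs_nonneg: "padic_abs p x \<ge> 0"
  by (simp add: padic_abs_def)

lemma padic_abs_eq_0_iff: "prime p \<Longrightarrow> padic_abs p x = 0 \<longleftrightarrow> x = 0"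
  by (auto simp: padic_abs_def dest: prime_gt_0_nat)

lemma padic_abs_1 [simp]: "padic_abs p 1 = 1"
  by (simp add: padic_abs_def padic_val_def)

lemma padic_abs_mult:
  assumes p: "prime p"
  shows "padic_abs p (x * y) = padic_abs p x * padic_abs p y"
proof (cases "x = 0 \<or> y = 0")
  case False
  obtain a b where x: "x = Fract a b" "b > 0" by (cases x)
  obtain c d where y: "y = Fract c d" "d > 0" by (cases y)
  have nz: "a \<noteq> 0" "c \<noteq> 0" using False x y by (auto simp: rat_number_collapse)
  have pe: "prime_elem (int p)" using p by simp
  have "padic_val p (x * y) = padic_val p x + padic_val p y"
    using x y nz by (simp add: padic_val_Fract[OF p] prime_elem_multiplicity_mult_distrib[OF pe])
  then show ?thesis
    using False prime_gt_0_nat[OF p]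
    by (simp add: padic_abs_def power_int_diff power_int_minus field_simps power_int_add)
qed auto

lemma padic_abs_uminus [simp]: "padic_abs p (- x) = padic_abs p x"
proof -
  obtain a b where q: "quotient_of x = (a, b)" by force
  have "multiplicity (int p) (- a) = multiplicity (int p) a" by (simp add: multiplicity_def)
  then show ?thesis by (simp add: padic_abs_def padic_val_def rat_uminus_code q)
qed

lemma padic_abs_ultrametric:
  assumes p: "prime p"
  shows "padic_abs p (x + y) \<le> max (padic_abs p x) (padic_abs p y)"
proof (cases "x = 0 \<or> y = 0 \<or> x + y = 0")
  case True
  then show ?thesis by (auto simp: padic_abs_nonneg le_max_iff_disj)
next
  case False
  obtain a b where ab: "x = Fract a b" "b > 0" by (cases x)
  obtain c d where cd: "y = Fract c d" "d > 0" by (cases y)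
  define e u v where "e = b * d" and "u = a * d" and "v = c * b"
  have x: "x = Fract u e" and y: "y = Fract v e" and e: "e \<noteq> 0"
    using ab cd by (simp_all add: e_def u_def v_def eq_rat)
  have xy: "x + y = Fract (u + v) e"
    using e by (simp add: x y eq_rat algebra_simps)
  have nz: "u \<noteq> 0" "v \<noteq> 0" "u + v \<noteq> 0"
    using False x y xy by (auto simp: rat_number_collapse)
  have "multiplicity (int p) (u + v) \<ge> min (multiplicity (int p) u) (multiplicity (int p) v)"
  proof (rule multiplicity_geI)
    show "int p ^ min (multiplicity (int p) u) (multiplicity (int p) v) dvd u + v"
      by (intro dvd_add multiplicity_dvd') auto
  qed (use nz p prime_gt_1_nat[OF p] in auto)
  then have v: "padic_val p (x + y) \<ge> min (padic_val p x) (padic_val p y)"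
    unfolding xy unfolding x y using nz e by (auto simp: padic_val_Fract[OF p])
  have p1: "real p \<ge> 1" using prime_gt_1_nat[OF p] by simp
  have "- padic_val p (x + y) \<le> - padic_val p x \<or> - padic_val p (x + y) \<le> - padic_val p y"
    using v by auto
  then have "real p powi (- padic_val p (x + y)) \<le> real p powi (- padic_val p x) \<or>
      real p powi (- padic_val p (x + y)) \<le> real p powi (- padic_val p y)"
    using p1 by (meson power_int_increasing)
  then show ?thesis using False by (auto simp: padic_abs_def le_max_iff_disj)
qed

lemma padic_abs_triangle:
  assumes p: "prime p"
  shows "padic_abs p (x + y) \<le> padic_abs p x + padic_abs p y"
  using padic_abs_ultrametric[OF p, of x y] padic_abs_nonneg[of p x] padic_abs_nonneg[of p y]
  by linarith

lemma padic_abs_diff_le: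
  assumes p: "prime p"
  shows "\<bar>padic_abs p x - padic_abs p y\<bar> \<le> padic_abs p (x - y)"
  using padic_abs_triangle[OF p, of "x - y" y] padic_abs_triangle[OF p, of "y - x" x]
    padic_abs_uminus[of p "x - y"]
  by simp

lemma padic_abs_inverse:
  assumes p: "prime p"
  shows "padic_abs p (inverse x) = inverse (padic_abs p x)"
proof (cases "x = 0")
  case False
  then have "padic_abs p x * padic_abs p (inverse x) = 1"
    using padic_abs_mult[OF p, of x "inverse x"] by simp
  then show ?thesis by (metis inverse_unique)
qed simp


section \<open>The field of \<open>p\<close>-adic numbers\<close>

text \<open>The completion of the rationals at \<open>p\<close>: Cauchy sequences modulo null sequences.\<close>

definition padic_Cauchy :: "nat \<Rightarrow> (nat \<Rightarrow> rat) \<Rightarrow> bool"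
  where "padic_Cauchy p f \<longleftrightarrow>
    (\<forall>e>0. \<exists>N. \<forall>m\<ge>N. \<forall>n\<ge>N. padic_abs p (f m - f n) < e)"

definition padic_Cauchy_ring :: "nat \<Rightarrow> (nat \<Rightarrow> rat) ring"
  where "padic_Cauchy_ring p =
    \<lparr>carrier = {f. padic_Cauchy p f}, mult = (\<lambda>f g n. f n * g n), one = (\<lambda>_. 1),
     zero = (\<lambda>_. 0), add = (\<lambda>f g n. f n + g n)\<rparr>"

definition padic_null :: "nat \<Rightarrow> (nat \<Rightarrow> rat) set"
  where "padic_null p = {f. (\<lambda>n. padic_abs p (f n)) \<longlonglongrightarrow> 0}"

definition padic_field :: "nat \<Rightarrow> (nat \<Rightarrow> rat) set ring"
  where "padic_field p = padic_Cauchy_ring p Quot padic_null p"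

definition padic_of_rat :: "nat \<Rightarrow> rat \<Rightarrow> (nat \<Rightarrow> rat) set"
  where "padic_of_rat p x = padic_null p +>\<^bsub>padic_Cauchy_ring p\<^esub> (\<lambda>_. x)"

text \<open>The limit below does not depend on the chosen representative; see
  \<open>padic_norm_coset\<close>.\<close>

definition padic_norm :: "nat \<Rightarrow> (nat \<Rightarrow> rat) set \<Rightarrow> real"
  where "padic_norm p X = lim (\<lambda>n. padic_abs p ((SOME f. f \<in> X) n))"

definition padic_integers :: "nat \<Rightarrow> (nat \<Rightarrow> rat) set set"
  where "padic_integers p = {X \<in> carrier (padic_field p). padic_norm p X \<le> 1}"

lemma padic_Cauchy_const [simp]: "padic_Cauchy p (\<lambda>_. x)"
  by (simp add: padic_Cauchy_def)

lemma padic_Cauchy_add: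
  assumes p: "prime p" and f: "padic_Cauchy p f" and g: "padic_Cauchy p g"
  shows "padic_Cauchy p (\<lambda>n. f n + g n)"
  unfolding padic_Cauchy_def
proof (intro allI impI)
  fix e :: real assume e: "e > 0"
  obtain M where M: "\<And>m n. m \<ge> M \<Longrightarrow> n \<ge> M \<Longrightarrow> padic_abs p (f m - f n) < e"
    using f e unfolding padic_Cauchy_def by meson
  obtain N where N: "\<And>m n. m \<ge> N \<Longrightarrow> n \<ge> N \<Longrightarrow> padic_abs p (g m - g n) < e"
    using g e unfolding padic_Cauchy_def by meson
  have "padic_abs p (f m + g m - (f n + g n)) < e" if "m \<ge> max M N" "n \<ge> max M N" for m n
    using padic_abs_ultrametric[OF p, of "f m - f n" "g m - g n"] M[of m n] N[of m n] that
    by (simp add: algebra_simps)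
  then show "\<exists>N. \<forall>m\<ge>N. \<forall>n\<ge>N. padic_abs p (f m + g m - (f n + g n)) < e" by blast
qed

lemma padic_Cauchy_uminus: "padic_Cauchy p f \<Longrightarrow> padic_Cauchy p (\<lambda>n. - f n)"
proof -
  have "padic_abs p (- f m - - f n) = padic_abs p (f m - f n)" for m n
    using padic_abs_uminus[of p "f m - f n"] by (simp del: padic_abs_uminus)
  then show "padic_Cauchy p f \<Longrightarrow> padic_Cauchy p (\<lambda>n. - f n)"
    by (simp add: padic_Cauchy_def)
qed

lemma padic_Cauchy_convergent:
  assumes p: "prime p" and f: "padic_Cauchy p f"
  shows "convergent (\<lambda>n. padic_abs p (f n))"
proof -
  have "Cauchy (\<lambda>n. padic_abs p (f n))"
    unfolding Cauchy_def dist_real_def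
  proof (intro allI impI)
    fix e :: real assume "e > 0"
    then obtain N where "\<forall>m\<ge>N. \<forall>n\<ge>N. padic_abs p (f m - f n) < e"
      using f unfolding padic_Cauchy_def by meson
    then show "\<exists>M. \<forall>m\<ge>M. \<forall>n\<ge>M. \<bar>padic_abs p (f m) - padic_abs p (f n)\<bar> < e"
      using padic_abs_diff_le[OF p] by (meson le_less_trans)
  qed
  then show ?thesis by (simp add: Cauchy_convergent_iff)
qed

lemma padic_Cauchy_bounded:
  assumes p: "prime p" and f: "padic_Cauchy p f"
  obtains K where "K > 0" "\<And>n. padic_abs p (f n) \<le> K"
proof -
  have "Bseq (\<lambda>n. padic_abs p (f n))"
    using padic_Cauchy_convergent[OF p f] by (rule convergent_imp_Bseq)
  then obtain K where "K > 0" "\<And>n. norm (padic_abs p (f n)) \<le> K" by (rule BseqE) blast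
  then show ?thesis using that padic_abs_nonneg by simp
qed

lemma padic_Cauchy_mult:
  assumes p: "prime p" and f: "padic_Cauchy p f" and g: "padic_Cauchy p g"
  shows "padic_Cauchy p (\<lambda>n. f n * g n)"
  unfolding padic_Cauchy_def
proof (intro allI impI)
  fix e :: real assume e: "e > 0"
  obtain K where K: "K > 0" "\<And>n. padic_abs p (f n) \<le> K" using padic_Cauchy_bounded[OF p f] by blast
  obtain L where L: "L > 0" "\<And>n. padic_abs p (g n) \<le> L" using padic_Cauchy_bounded[OF p g] by blast
  obtain M where M: "\<And>m n. m \<ge> M \<Longrightarrow> n \<ge> M \<Longrightarrow> padic_abs p (f m - f n) < e / L"
    using f e L(1) unfolding padic_Cauchy_def by (meson divide_pos_pos)
  obtain N where N: "\<And>m n. m \<ge> N \<Longrightarrow> n \<ge> N \<Longrightarrow> padic_abs p (g m - g n) < e / K"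
    using g e K(1) unfolding padic_Cauchy_def by (meson divide_pos_pos)
  have "padic_abs p (f m * g m - f n * g n) < e" if mn: "m \<ge> max M N" "n \<ge> max M N" for m n
  proof -
    have "padic_abs p (f m * (g m - g n)) \<le> K * padic_abs p (g m - g n)"
      unfolding padic_abs_mult[OF p] using K(2) padic_abs_nonneg by (intro mult_right_mono)
    also have "\<dots> < e" using N[of m n] mn K(1) by (simp add: field_simps)
    finally have 1: "padic_abs p (f m * (g m - g n)) < e" .
    have "padic_abs p ((f m - f n) * g n) \<le> padic_abs p (f m - f n) * L"
      unfolding padic_abs_mult[OF p] using L(2) padic_abs_nonneg by (intro mult_left_mono)
    also have "\<dots> < e" using M[of m n] mn L(1) by (simp add: field_simps)
    finally have 2: "padic_abs p ((f m - f n) * g n) < e" .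
    have "f m * g m - f n * g n = f m * (g m - g n) + (f m - f n) * g n"
      by (simp add: algebra_simps)
    then show ?thesis
      using padic_abs_ultrametric[OF p, of "f m * (g m - g n)" "(f m - f n) * g n"] 1 2 by simp
  qed
  then show "\<exists>N. \<forall>m\<ge>N. \<forall>n\<ge>N. padic_abs p (f m * g m - f n * g n) < e" by blast
qed

lemma padic_null_Cauchy:
  assumes p: "prime p" and f: "f \<in> padic_null p"
  shows "padic_Cauchy p f"
  unfolding padic_Cauchy_def
proof (intro allI impI)
  fix e :: real assume "e > 0"
  then have "eventually (\<lambda>n. padic_abs p (f n) < e) sequentially"
    using f by (auto simp: padic_null_def intro: order_tendstoD)
  then obtain N where N: "\<And>n. n \<ge> N \<Longrightarrow> padic_abs p (f n) < e"
    by (auto simp: eventually_sequentially)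
  have "padic_abs p (f m - f n) < e" if "m \<ge> N" "n \<ge> N" for m n
    using padic_abs_ultrametric[OF p, of "f m" "- f n"] N[of m] N[of n] that by simp
  then show "\<exists>N. \<forall>m\<ge>N. \<forall>n\<ge>N. padic_abs p (f m - f n) < e" by blast
qed

lemma padic_Cauchy_ring_cring:
  assumes p: "prime p"
  shows "cring (padic_Cauchy_ring p)"
proof (rule cringI)
  show "abelian_group (padic_Cauchy_ring p)"
  proof (rule abelian_groupI)
    fix f assume "f \<in> carrier (padic_Cauchy_ring p)"
    then show "\<exists>g\<in>carrier (padic_Cauchy_ring p).
        g \<oplus>\<^bsub>padic_Cauchy_ring p\<^esub> f = \<zero>\<^bsub>padic_Cauchy_ring p\<^esub>"
      by (intro bexI[of _ "\<lambda>n. - f n"]) (auto simp: padic_Cauchy_ring_def padic_Cauchy_uminus)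
  qed (auto simp: padic_Cauchy_ring_def algebra_simps intro: padic_Cauchy_add[OF p])
  show "Group.comm_monoid (padic_Cauchy_ring p)"
    by (rule comm_monoidI)
      (auto simp: padic_Cauchy_ring_def algebra_simps intro: padic_Cauchy_mult[OF p])
qed (auto simp: padic_Cauchy_ring_def algebra_simps)

lemma padic_null_mult:
  assumes p: "prime p" and f: "f \<in> padic_null p" and g: "padic_Cauchy p g"
  shows "(\<lambda>n. g n * f n) \<in> padic_null p"
proof -
  obtain l where "(\<lambda>n. padic_abs p (g n)) \<longlonglongrightarrow> l"
    using padic_Cauchy_convergent[OF p g] by (auto simp: convergent_def)
  then have "(\<lambda>n. padic_abs p (g n) * padic_abs p (f n)) \<longlonglongrightarrow> l * 0"
    by (rule tendsto_mult) (use f in \<open>simp add: padic_null_def\<close>)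
  moreover have "padic_abs p (g n * f n) = padic_abs p (g n) * padic_abs p (f n)" for n
    by (rule padic_abs_mult[OF p])
  ultimately show ?thesis by (simp only: padic_null_def mem_Collect_eq mult_zero_right)
qed

lemma padic_null_add:
  assumes p: "prime p" and f: "f \<in> padic_null p" and g: "g \<in> padic_null p"
  shows "(\<lambda>n. f n + g n) \<in> padic_null p"
proof -
  have "(\<lambda>n. padic_abs p (f n)) \<longlonglongrightarrow> 0" "(\<lambda>n. padic_abs p (g n)) \<longlonglongrightarrow> 0"
    using f g by (simp_all only: padic_null_def mem_Collect_eq)
  from tendsto_add[OF this]
  have sum: "(\<lambda>n. padic_abs p (f n) + padic_abs p (g n)) \<longlonglongrightarrow> 0" by (simp only: add_0_left)
  have "(\<lambda>n. padic_abs p (f n + g n)) \<longlonglongrightarrow> 0"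
    by (rule tendsto_sandwich[OF _ _ tendsto_const sum])
      (intro always_eventually allI padic_abs_nonneg padic_abs_triangle[OF p])+
  then show ?thesis by (simp only: padic_null_def mem_Collect_eq)
qed

lemma padic_Cauchy_ring_a_inv:
  assumes p: "prime p" and f: "padic_Cauchy p f"
  shows "\<ominus>\<^bsub>padic_Cauchy_ring p\<^esub> f = (\<lambda>n. - f n)"
proof -
  interpret cring "padic_Cauchy_ring p" using padic_Cauchy_ring_cring[OF p] .
  show ?thesis
    by (rule minus_equality) (use f in \<open>auto simp: padic_Cauchy_ring_def padic_Cauchy_uminus\<close>)
qed

lemma padic_null_ideal:
  assumes p: "prime p"
  shows "ideal (padic_null p) (padic_Cauchy_ring p)"
proof -
  interpret cring "padic_Cauchy_ring p" using padic_Cauchy_ring_cring[OF p] .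
  have sub: "padic_null p \<subseteq> carrier (padic_Cauchy_ring p)"
    using padic_null_Cauchy[OF p] by (auto simp: padic_Cauchy_ring_def)
  show ?thesis
  proof (rule idealI)
    show "subgroup (padic_null p) (add_monoid (padic_Cauchy_ring p))"
    proof (rule add.subgroupI)
      show "padic_null p \<subseteq> carrier (padic_Cauchy_ring p)" by (rule sub)
      have "(\<lambda>_. 0) \<in> padic_null p" by (simp add: padic_null_def)
      then show "padic_null p \<noteq> {}" by blast
    next
      fix f assume f: "f \<in> padic_null p"
      show "\<ominus>\<^bsub>padic_Cauchy_ring p\<^esub> f \<in> padic_null p"
        unfolding padic_Cauchy_ring_a_inv[OF p padic_null_Cauchy[OF p f]]
        using f by (simp add: padic_null_def)
    next
      fix f g assume "f \<in> padic_null p" "g \<in> padic_null p"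
      then show "f \<oplus>\<^bsub>padic_Cauchy_ring p\<^esub> g \<in> padic_null p"
        using padic_null_add[OF p, of f g] by (simp add: padic_Cauchy_ring_def)
    qed
    show "ring (padic_Cauchy_ring p)" by (rule ring_axioms)
  next
    fix a x assume "a \<in> padic_null p" "x \<in> carrier (padic_Cauchy_ring p)"
    then show "x \<otimes>\<^bsub>padic_Cauchy_ring p\<^esub> a \<in> padic_null p"
      using padic_null_mult[OF p, of a x] by (simp add: padic_Cauchy_ring_def)
  next
    fix a x assume "a \<in> padic_null p" "x \<in> carrier (padic_Cauchy_ring p)"
    then show "a \<otimes>\<^bsub>padic_Cauchy_ring p\<^esub> x \<in> padic_null p"
      using padic_null_mult[OF p, of a x] by (simp add: padic_Cauchy_ring_def mult.commute)
  qed
qed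

lemma padic_coset_iff:
  assumes p: "prime p" and f: "padic_Cauchy p f"
  shows "g \<in> padic_null p +>\<^bsub>padic_Cauchy_ring p\<^esub> f \<longleftrightarrow> (\<lambda>n. g n - f n) \<in> padic_null p"
proof -
  have "g \<in> padic_null p +>\<^bsub>padic_Cauchy_ring p\<^esub> f \<longleftrightarrow>
      (\<exists>h\<in>padic_null p. g = (\<lambda>n. h n + f n))"
    by (auto simp: a_r_coset_def' padic_Cauchy_ring_def)
  also have "\<dots> \<longleftrightarrow> (\<lambda>n. g n - f n) \<in> padic_null p"
  proof
    assume "\<exists>h\<in>padic_null p. g = (\<lambda>n. h n + f n)"
    then obtain h where "h \<in> padic_null p" "g = (\<lambda>n. h n + f n)" by blast
    then show "(\<lambda>n. g n - f n) \<in> padic_null p" by simp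
  next
    assume "(\<lambda>n. g n - f n) \<in> padic_null p"
    then show "\<exists>h\<in>padic_null p. g = (\<lambda>n. h n + f n)"
      by (intro bexI[of _ "\<lambda>n. g n - f n"]) auto
  qed
  finally show ?thesis .
qed

lemma padic_norm_coset:
  assumes p: "prime p" and f: "padic_Cauchy p f"
  shows "padic_norm p (padic_null p +>\<^bsub>padic_Cauchy_ring p\<^esub> f) = lim (\<lambda>n. padic_abs p (f n))"
proof -
  let ?X = "padic_null p +>\<^bsub>padic_Cauchy_ring p\<^esub> f"
  define g where "g = (SOME f. f \<in> ?X)"
  have "(\<lambda>n. f n - f n) \<in> padic_null p" by (simp add: padic_null_def)
  then have "f \<in> ?X" by (simp add: padic_coset_iff[OF p f])
  then have "g \<in> ?X" unfolding g_def by (rule someI[of "\<lambda>h. h \<in> ?X"])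
  then have "(\<lambda>n. g n - f n) \<in> padic_null p" by (simp add: padic_coset_iff[OF p f])
  then have "(\<lambda>n. padic_abs p (g n - f n)) \<longlonglongrightarrow> 0" by (simp add: padic_null_def)
  then have d: "(\<lambda>n. padic_abs p (g n) - padic_abs p (f n)) \<longlonglongrightarrow> 0"
  proof (rule tendsto_0_le[where K = 1], intro always_eventually allI)
    show "norm (padic_abs p (g n) - padic_abs p (f n)) \<le> norm (padic_abs p (g n - f n)) * 1" for n
      using padic_abs_diff_le[OF p, of "g n" "f n"] padic_abs_nonneg[of p "g n - f n"] by simp
  qed
  have "(\<lambda>n. padic_abs p (f n)) \<longlonglongrightarrow> lim (\<lambda>n. padic_abs p (f n))"
    using padic_Cauchy_convergent[OF p f] by (simp add: convergent_LIMSEQ_iff)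
  from tendsto_add[OF d this] have "(\<lambda>n. padic_abs p (g n)) \<longlonglongrightarrow> lim (\<lambda>n. padic_abs p (f n))"
    by simp
  then show ?thesis unfolding padic_norm_def g_def[symmetric] by (rule limI)
qed

lemma padic_norm_of_rat: "prime p \<Longrightarrow> padic_norm p (padic_of_rat p x) = padic_abs p x"
  using limI[OF tendsto_const, of "padic_abs p x"] by (simp add: padic_of_rat_def padic_norm_coset)

lemma padic_field_cring: "prime p \<Longrightarrow> cring (padic_field p)"
  unfolding padic_field_def
  by (intro ideal.quotient_is_cring padic_null_ideal padic_Cauchy_ring_cring)

lemma padic_Cauchy_inverse:
  assumes p: "prime p" and f: "padic_Cauchy p f" and nn: "f \<notin> padic_null p"
  shows "padic_Cauchy p (\<lambda>n. inverse (f n))" "(\<lambda>n. inverse (f n) * f n - 1) \<in> padic_null p"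
proof -
  obtain l where l: "(\<lambda>n. padic_abs p (f n)) \<longlonglongrightarrow> l"
    using padic_Cauchy_convergent[OF p f] by (auto simp: convergent_def)
  have "l \<ge> 0" using l padic_abs_nonneg by (intro LIMSEQ_le_const[OF l]) auto
  moreover have "l \<noteq> 0" using l nn by (auto simp: padic_null_def)
  ultimately have l0: "l > 0" by simp
  then have "eventually (\<lambda>n. padic_abs p (f n) > l / 2) sequentially"
    using order_tendstoD(1)[OF l, of "l / 2"] by simp
  then obtain M where M: "\<And>n. n \<ge> M \<Longrightarrow> padic_abs p (f n) > l / 2"
    by (auto simp: eventually_sequentially)
  have nz: "f n \<noteq> 0" if "n \<ge> M" for n using M[OF that] l0 by auto
  show "padic_Cauchy p (\<lambda>n. inverse (f n))"
    unfolding padic_Cauchy_def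
  proof (intro allI impI)
    fix e :: real assume e: "e > 0"
    have "e * (l / 2 * (l / 2)) > 0" using e l0 by simp
    then obtain N where N: "\<forall>m\<ge>N. \<forall>n\<ge>N. padic_abs p (f m - f n) < e * (l / 2 * (l / 2))"
      using f unfolding padic_Cauchy_def by blast
    have "padic_abs p (inverse (f m) - inverse (f n)) < e" if mn: "m \<ge> max M N" "n \<ge> max M N" for m n
    proof -
      have 1: "f m \<noteq> 0" "f n \<noteq> 0" using nz mn by auto
      have pos: "padic_abs p (f m) > 0" "padic_abs p (f n) > 0"
        using M[of m] M[of n] mn l0 by auto
      have eq: "(inverse (f m) - inverse (f n)) * (f m * f n) = - (f m - f n)"
        using 1 by (simp add: field_simps)
      have "padic_abs p (inverse (f m) - inverse (f n)) * (padic_abs p (f m) * padic_abs p (f n)) =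
          padic_abs p (f m - f n)"
        using arg_cong[OF eq, of "padic_abs p"] unfolding padic_abs_mult[OF p] padic_abs_uminus .
      also have "\<dots> < e * (l / 2 * (l / 2))" using N mn by simp
      also have "\<dots> \<le> e * (padic_abs p (f m) * padic_abs p (f n))"
        using M[of m] M[of n] mn l0 e by (intro mult_left_mono mult_mono) auto
      finally show ?thesis using pos by (simp add: mult_less_cancel_right)
    qed
    then show "\<exists>N. \<forall>m\<ge>N. \<forall>n\<ge>N. padic_abs p (inverse (f m) - inverse (f n)) < e" by blast
  qed
  have "eventually (\<lambda>n. padic_abs p (inverse (f n) * f n - 1) = 0) sequentially"
    using eventually_ge_at_top[of M] by eventually_elim (simp add: nz)
  then have "(\<lambda>n. padic_abs p (inverse (f n) * f n - 1)) \<longlonglongrightarrow> 0"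
    by (rule tendsto_eventually)
  then show "(\<lambda>n. inverse (f n) * f n - 1) \<in> padic_null p"
    by (simp add: padic_null_def)
qed

lemma padic_field_carrier:
  "carrier (padic_field p) =
    {padic_null p +>\<^bsub>padic_Cauchy_ring p\<^esub> f | f. padic_Cauchy p f}"
proof -
  have "carrier (padic_field p) =
      {padic_null p +>\<^bsub>padic_Cauchy_ring p\<^esub> f | f. f \<in> carrier (padic_Cauchy_ring p)}"
    unfolding padic_field_def FactRing_simps by auto
  then show ?thesis by (simp add: padic_Cauchy_ring_def)
qed

lemma padic_coset_mult:
  assumes p: "prime p" and "padic_Cauchy p f" "padic_Cauchy p g"
  shows "(padic_null p +>\<^bsub>padic_Cauchy_ring p\<^esub> f) \<otimes>\<^bsub>padic_field p\<^esub>
      (padic_null p +>\<^bsub>padic_Cauchy_ring p\<^esub> g) =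
    padic_null p +>\<^bsub>padic_Cauchy_ring p\<^esub> (\<lambda>n. f n * g n)"
proof -
  have "f \<in> carrier (padic_Cauchy_ring p)" "g \<in> carrier (padic_Cauchy_ring p)"
    using assms by (simp_all add: padic_Cauchy_ring_def)
  from ideal.rcoset_mult_add[OF padic_null_ideal[OF p] this]
  have "(padic_null p +>\<^bsub>padic_Cauchy_ring p\<^esub> f) \<otimes>\<^bsub>padic_field p\<^esub>
      (padic_null p +>\<^bsub>padic_Cauchy_ring p\<^esub> g) =
    padic_null p +>\<^bsub>padic_Cauchy_ring p\<^esub> (f \<otimes>\<^bsub>padic_Cauchy_ring p\<^esub> g)"
    by (simp add: padic_field_def FactRing_def)
  moreover have "f \<otimes>\<^bsub>padic_Cauchy_ring p\<^esub> g = (\<lambda>n. f n * g n)"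
    by (simp add: padic_Cauchy_ring_def)
  ultimately show ?thesis by simp
qed

theorem padic_field_field:
  assumes p: "prime p"
  shows "field (padic_field p)"
proof -
  let ?C = "padic_Cauchy_ring p" and ?N = "padic_null p"
  interpret I: ideal ?N ?C using padic_null_ideal[OF p] .
  interpret F: cring "padic_field p" using padic_field_cring[OF p] .
  have zero: "\<zero>\<^bsub>padic_field p\<^esub> = ?N" by (simp add: padic_field_def FactRing_def)
  have "\<one>\<^bsub>?C\<^esub> = (\<lambda>_. 1)" by (simp add: padic_Cauchy_ring_def)
  then have one: "\<one>\<^bsub>padic_field p\<^esub> = ?N +>\<^bsub>?C\<^esub> (\<lambda>_. 1)"
    by (simp add: padic_field_def FactRing_def)
  show ?thesis
  proof (rule F.cring_fieldI2)
    have "(\<lambda>_::nat. 1 - 1 :: rat) \<in> ?N" by (simp add: padic_null_def)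
    then have "(\<lambda>_. 1) \<in> ?N +>\<^bsub>?C\<^esub> (\<lambda>_. 1)"
      by (simp add: padic_coset_iff[OF p])
    moreover have "(\<lambda>_. 1) \<notin> ?N" by (simp add: padic_null_def LIMSEQ_const_iff)
    ultimately show "\<zero>\<^bsub>padic_field p\<^esub> \<noteq> \<one>\<^bsub>padic_field p\<^esub>" unfolding zero one by blast
  next
    fix X assume X: "X \<in> carrier (padic_field p)" "X \<noteq> \<zero>\<^bsub>padic_field p\<^esub>"
    obtain f where f: "X = ?N +>\<^bsub>?C\<^esub> f" "padic_Cauchy p f"
      using X(1) by (auto simp: padic_field_carrier)
    have "f \<notin> ?N"
      using X(2) f I.a_rcos_const[of f] unfolding zero by auto
    note inv = padic_Cauchy_inverse[OF p f(2) this]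
    let ?g = "\<lambda>n. inverse (f n)"
    have 1: "(\<lambda>n. f n * ?g n) \<in> ?N +>\<^bsub>?C\<^esub> (\<lambda>_. 1)"
      using inv(2) by (simp add: padic_coset_iff[OF p] mult.commute)
    have 2: "(\<lambda>_. 1) \<in> carrier ?C" by (simp add: padic_Cauchy_ring_def)
    have "?N +>\<^bsub>?C\<^esub> (\<lambda>n. f n * ?g n) = ?N +>\<^bsub>?C\<^esub> (\<lambda>_. 1)"
      using I.a_repr_independence[OF 1 2 I.a_subgroup] by (rule sym)
    then have "X \<otimes>\<^bsub>padic_field p\<^esub> (?N +>\<^bsub>?C\<^esub> ?g) = \<one>\<^bsub>padic_field p\<^esub>"
      unfolding one f(1) padic_coset_mult[OF p f(2) inv(1)] .
    moreover have "?N +>\<^bsub>?C\<^esub> ?g \<in> carrier (padic_field p)"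
      unfolding padic_field_carrier using inv(1) by blast
    ultimately show "\<exists>Y\<in>carrier (padic_field p). X \<otimes>\<^bsub>padic_field p\<^esub> Y = \<one>\<^bsub>padic_field p\<^esub>"
      by blast
  qed
qed

lemma padic_of_rat_in_padic_integers_iff:
  assumes p: "prime p"
  shows "padic_of_rat p x \<in> padic_integers p \<longleftrightarrow> padic_abs p x \<le> 1"
proof -
  have "padic_of_rat p x \<in> carrier (padic_field p)"
    unfolding padic_of_rat_def padic_field_carrier using padic_Cauchy_const by blast
  then show ?thesis by (simp add: padic_integers_def padic_norm_of_rat[OF p])
qed


section \<open>Adjoining \<open>i\<close>\<close>

text \<open>For \<open>R\<close> a commutative ring, \<open>R[X]/(X\<^sup>2 + 1)\<close>, with \<open>(x, y)\<close> standing for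
  \<open>x + y i\<close>. If \<open>R\<close> is a field in which \<open>- 1\<close> is not a square (such as the field of \<open>p\<close>-adic
  numbers for a prime \<open>p\<close> that is 3 modulo 4), this is the field \<open>R(i)\<close>.\<close>

definition adjoin_i :: "('a, 'b) ring_scheme \<Rightarrow> ('a \<times> 'a) ring"
  where "adjoin_i R =
    \<lparr>carrier = carrier R \<times> carrier R,
     mult = (\<lambda>(a, b) (c, d). (a \<otimes>\<^bsub>R\<^esub> c \<ominus>\<^bsub>R\<^esub> b \<otimes>\<^bsub>R\<^esub> d, a \<otimes>\<^bsub>R\<^esub> d \<oplus>\<^bsub>R\<^esub> b \<otimes>\<^bsub>R\<^esub> c)),
     one = (\<one>\<^bsub>R\<^esub>, \<zero>\<^bsub>R\<^esub>),
     zero = (\<zero>\<^bsub>R\<^esub>, \<zero>\<^bsub>R\<^esub>),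
     add = (\<lambda>(a, b) (c, d). (a \<oplus>\<^bsub>R\<^esub> c, b \<oplus>\<^bsub>R\<^esub> d))\<rparr>"

definition padic_gaussian_field :: "nat \<Rightarrow> ((nat \<Rightarrow> rat) set \<times> (nat \<Rightarrow> rat) set) ring"
  where "padic_gaussian_field p = adjoin_i (padic_field p)"

definition padic_gaussian_integers :: "nat \<Rightarrow> ((nat \<Rightarrow> rat) set \<times> (nat \<Rightarrow> rat) set) set"
  where "padic_gaussian_integers p =
    {(x, y) \<in> carrier (padic_gaussian_field p). x \<in> padic_integers p \<and> y \<in> padic_integers p}"

text \<open>The inclusion of \<open>\<rat>(i)\<close>, meaningful only on \<^const>\<open>gaussian_rationals\<close>.\<close>

definition padic_of_gaussian_rational ::
    "nat \<Rightarrow> complex \<Rightarrow> (nat \<Rightarrow> rat) set \<times> (nat \<Rightarrow> rat) set"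
  where "padic_of_gaussian_rational p z =
    (padic_of_rat p (the_inv of_rat (Re z)), padic_of_rat p (the_inv of_rat (Im z)))"

lemma padic_of_gaussian_rational_Complex:
  "padic_of_gaussian_rational p (Complex (of_rat a) (of_rat b)) = (padic_of_rat p a, padic_of_rat p b)"
proof -
  have "inj (of_rat :: rat \<Rightarrow> real)" by (simp add: inj_on_def)
  then show ?thesis by (simp add: padic_of_gaussian_rational_def the_inv_f_f)
qed

end

theory Submission
  imports Defs "HOL-Number_Theory.Residues"
begin

text \<open>Since \<open>p\<close> is inert in \<open>\<int>[i]\<close>, the valuation of \<open>x + iy\<close> is the multiplicity of \<open>p\<close> in
  \<open>gcd x y\<close>, that is, the number of \<open>k \<ge> 1\<close> such that \<open>p\<^sup>k\<close> divides both \<open>x\<close> and \<open>y\<close>. Hence the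
  valuation of the product over a box is the sum over \<open>k\<close> of the products of the numbers of
  multiples of \<open>p\<^sup>k\<close> in the two sides, and a side \<open>{A - C + 1..A}\<close> contains at least as many
  multiples of \<open>p\<^sup>k\<close> as \<open>{1..C}\<close> does.\<close>

section \<open>Inertness of \<open>p\<close> and extraction of powers of \<open>p\<close> in the
  Gaussian integers\<close>

text \<open>\<open>fermat_theorem\<close> concerns natural numbers, so it is applied to the absolute
  value of \<open>x\<close>; for odd \<open>p\<close> the exponent \<open>p - 1\<close> is even and
  the sign disappears.\<close>

lemma fermat_theorem_int:
  fixes x :: int
  assumes "prime p" "\<not> int p dvd x"
  shows "[x ^ (p - 1) = 1] (mod int p)"
proof (cases "p = 2")
  case True
  then show ?thesis using assms(2) by (simp add: cong_iff_dvd_diff)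
next
  case False
  have "\<not> p dvd nat \<bar>x\<bar>"
    using assms(2) by (metis dvd_abs_iff int_dvd_int_iff nat_0_le abs_ge_zero)
  from fermat_theorem[OF assms(1) this] have "[\<bar>x\<bar> ^ (p - 1) = 1] (mod int p)"
    by (metis abs_ge_zero cong_int_iff nat_0_le of_nat_1 of_nat_power)
  moreover have "even (p - 1)"
    using False assms(1) prime_odd_nat[of p] prime_ge_2_nat[of p] by simp
  ultimately show ?thesis by (simp add: power_even_abs)
qed

text \<open>Otherwise raising \<open>x^2 = -y^2\<close> to the power \<open>(p - 1) div 2\<close>,
  which is odd for such \<open>p\<close>, would give 1 = -1 modulo \<open>p\<close> by
  Fermat.\<close>

lemma prime_3_mod_4_dvd_sum_squares:
  fixes x y :: int
  assumes p: "prime p" "[p = 3] (mod 4)" and dvd: "int p dvd x\<^sup>2 + y\<^sup>2"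
  shows "int p dvd x" "int p dvd y"
proof -
  have pr: "prime (int p)" using p by simp
  have p4: "p mod 4 = 3" using p(2) by (simp add: cong_def)
  have iff: "int p dvd x \<longleftrightarrow> int p dvd y"
    using dvd_add_right_iff[of "int p" "x\<^sup>2" "y\<^sup>2"] dvd_add_left_iff[of "int p" "y\<^sup>2" "x\<^sup>2"] dvd
      prime_dvd_power_iff[OF pr, of 2] by auto
  have "int p dvd x"
  proof (rule ccontr)
    assume nd: "\<not> int p dvd x"
    define k where "k = (p - 1) div 2"
    have k: "p - 1 = 2 * k" "odd k" unfolding k_def using p4 by presburger+
    have "[x\<^sup>2 = - (y\<^sup>2)] (mod int p)" using dvd by (simp add: cong_iff_dvd_diff)
    then have "[x ^ (p - 1) = - (y ^ (p - 1))] (mod int p)"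
      using cong_pow[of "x\<^sup>2" "- (y\<^sup>2)" "int p" k] k by (simp add: power_mult)
    moreover have "[- (y ^ (p - 1)) = - 1] (mod int p)"
      using fermat_theorem_int[OF p(1)] nd iff by (simp add: cong_minus_minus_iff)
    ultimately have "[1 = - 1] (mod int p)"
      using fermat_theorem_int[OF p(1) nd] by (meson cong_sym cong_trans)
    then have "int p dvd 2" by (simp add: cong_iff_dvd_diff)
    then have "p \<le> 2" using zdvd_imp_le by fastforce
    then show False using p4 p(1) by (cases "p = 2") (use prime_ge_2_nat[of p] in auto)
  qed
  with iff show "int p dvd x" "int p dvd y" by auto
qed

text \<open>If \<open>p\<close> divided the norm of the cofactor \<open>u + iv\<close>, it would
  divide \<open>u\<close> and \<open>v\<close>, and one more power of \<open>p\<close> would divide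
  the gcd. A norm prime to \<open>p\<close> expresses that the cofactor is a unit of Z_p[i].\<close>

lemma gaussian_int_decompose:
  fixes x y :: int
  assumes p: "prime p" "[p = 3] (mod 4)" and nz: "(x, y) \<noteq> (0, 0)"
  obtains u v where "x = int p ^ multiplicity (int p) (gcd x y) * u"
    "y = int p ^ multiplicity (int p) (gcd x y) * v" "\<not> int p dvd u\<^sup>2 + v\<^sup>2"
proof -
  let ?m = "multiplicity (int p) (gcd x y)"
  have g: "gcd x y \<noteq> 0" using nz by auto
  have "int p ^ ?m dvd gcd x y" by (rule multiplicity_dvd)
  then obtain u v where uv: "x = int p ^ ?m * u" "y = int p ^ ?m * v"
    by (meson dvdE dvd_trans gcd_dvd1 gcd_dvd2)
  have "\<not> int p dvd u\<^sup>2 + v\<^sup>2"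
  proof
    assume "int p dvd u\<^sup>2 + v\<^sup>2"
    note prime_3_mod_4_dvd_sum_squares[OF p this]
    then have "int p ^ Suc ?m dvd x" "int p ^ Suc ?m dvd y"
      using uv by (metis dvd_refl mult_dvd_mono power_Suc2)+
    then have "int p ^ Suc ?m dvd gcd x y" by simp
    then show False
      using g p(1) by (subst (asm) power_dvd_iff_le_multiplicity) auto
  qed
  with uv show ?thesis by (rule that)
qed

text \<open>Exponents add up, and the cofactors multiply to one whose norm is again prime to
  \<open>p\<close>, because the norm is multiplicative.\<close>

lemma prod_gaussian_int_decompose:
  fixes f g :: "'a \<Rightarrow> int"
  assumes p: "prime p" "[p = 3] (mod 4)"
    and fin: "finite S" and nz: "\<And>s. s \<in> S \<Longrightarrow> (f s, g s) \<noteq> (0, 0)"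
  obtains u v :: int where
    "(\<Prod>s\<in>S. of_int (f s) + \<i> * of_int (g s)) =
      of_nat p ^ (\<Sum>s\<in>S. multiplicity (int p) (gcd (f s) (g s))) * (of_int u + \<i> * of_int v)"
    "\<not> int p dvd u\<^sup>2 + v\<^sup>2"
proof -
  let ?P = "\<lambda>S. \<exists>u v :: int. (\<Prod>s\<in>S. of_int (f s) + \<i> * of_int (g s)) =
      of_nat p ^ (\<Sum>s\<in>S. multiplicity (int p) (gcd (f s) (g s))) * (of_int u + \<i> * of_int v) \<and>
      \<not> int p dvd u\<^sup>2 + v\<^sup>2"
  have "?P S" using fin nz
  proof (induction S)
    case empty
    have "\<not> int p dvd 1" using p(1) not_prime_unit[of "int p"] by auto
    then show ?case by (intro exI[of _ 1] exI[of _ 0]) simp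
  next
    case (insert s S)
    let ?m = "multiplicity (int p) (gcd (f s) (g s))"
    obtain u v where uv: "(\<Prod>s\<in>S. of_int (f s) + \<i> * of_int (g s)) =
        of_nat p ^ (\<Sum>s\<in>S. multiplicity (int p) (gcd (f s) (g s))) * (of_int u + \<i> * of_int v)"
      "\<not> int p dvd u\<^sup>2 + v\<^sup>2"
      using insert by auto
    obtain a b where ab: "f s = int p ^ ?m * a" "g s = int p ^ ?m * b" "\<not> int p dvd a\<^sup>2 + b\<^sup>2"
      using gaussian_int_decompose[OF p insert.prems[of s]] by auto
    have 1: "of_int (f s) + \<i> * of_int (g s) = of_nat p ^ ?m * (of_int a + \<i> * of_int b)"
      by (subst ab(1), subst ab(2)) (simp add: algebra_simps)
    have 2: "(of_int a + \<i> * of_int b) * (of_int u + \<i> * of_int v) =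
        of_int (a * u - b * v) + \<i> * of_int (a * v + b * u)"
      by (simp add: complex_eq_iff)
    \<comment> \<open>Multiplicativity of the norm (the Brahmagupta-Fibonacci identity).\<close>
    have "(a * u - b * v)\<^sup>2 + (a * v + b * u)\<^sup>2 = (a\<^sup>2 + b\<^sup>2) * (u\<^sup>2 + v\<^sup>2)"
      by (simp add: power2_eq_square algebra_simps)
    then have 3: "\<not> int p dvd (a * u - b * v)\<^sup>2 + (a * v + b * u)\<^sup>2"
      using ab(3) uv(2) p(1) by (simp add: prime_dvd_mult_iff)
    have "(\<Prod>s\<in>insert s S. of_int (f s) + \<i> * of_int (g s)) =
        of_nat p ^ (\<Sum>s\<in>insert s S. multiplicity (int p) (gcd (f s) (g s))) *
        ((of_int a + \<i> * of_int b) * (of_int u + \<i> * of_int v))"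
      using insert.hyps by (simp add: 1 uv(1) power_add mult_ac)
    with 2 3 show ?case by metis
  qed
  then show ?thesis using that by blast
qed

section \<open>Valuations as counts of multiples of prime powers\<close>

text \<open>Every \<open>k\<close> with \<open>p^k\<close> dividing \<open>n\<close> satisfies
  \<open>k < p^k <= n <= K\<close>, so the cutoff loses nothing. A cutoff independent of
  \<open>n\<close> allows sums over \<open>n\<close> and \<open>k\<close> to be interchanged
  later.\<close>

lemma multiplicity_eq_card:
  fixes n :: int
  assumes p: "prime p" and n: "0 < n" "n \<le> int K"
  shows "multiplicity (int p) n = card {k \<in> {1..K}. int p ^ k dvd n}"
proof -
  have iff: "int p ^ k dvd n \<longleftrightarrow> k \<le> multiplicity (int p) n" for k
    using n(1) p by (intro power_dvd_iff_le_multiplicity) auto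
  have "k < K" if "int p ^ k dvd n" for k
  proof -
    have "k < p ^ k" using prime_ge_2_nat[OF p] by (simp add: power_gt_expt)
    moreover have "int p ^ k \<le> n" using that n(1) by (rule zdvd_imp_le)
    ultimately show ?thesis using n(2) by (metis less_le_trans of_nat_less_iff of_nat_power)
  qed
  then have "{k \<in> {1..K}. int p ^ k dvd n} = {1..multiplicity (int p) n}"
    using iff by force
  then show ?thesis by simp
qed

text \<open>The multiples are \<open>q * d\<close> with \<open>a div d < q <= b div d\<close>. Since
  \<open>div\<close> rounds down, this also covers negative endpoints, and \<open>nat\<close>
  returns 0 when \<open>b < a\<close>.\<close>

lemma card_multiples:
  fixes a b d :: int
  assumes "d > 0"
  shows "card {x \<in> {a + 1..b}. d dvd x} = nat (b div d - a div d)"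
proof -
  have "bij_betw (\<lambda>q. q * d) {a div d + 1..b div d} {x \<in> {a + 1..b}. d dvd x}"
  proof (rule bij_betw_byWitness[where f' = "\<lambda>x. x div d"])
    have le: "q * d \<le> n \<longleftrightarrow> q \<le> n div d" for q n
    proof
      assume "q * d \<le> n"
      then show "q \<le> n div d" using zdiv_mono1[of "q * d" n d] assms by simp
    next
      assume "q \<le> n div d"
      then have "q * d \<le> n div d * d" using assms by simp
      also have "\<dots> \<le> n" using assms by (simp add: minus_mod_eq_div_mult [symmetric])
      finally show "q * d \<le> n" .
    qed
    have "a < q * d \<longleftrightarrow> a div d < q" "q * d \<le> b \<longleftrightarrow> q \<le> b div d" for q
      using le[of q a] le[of q b] by auto
    then show "(\<lambda>q. q * d) ` {a div d + 1..b div d} \<subseteq> {x \<in> {a + 1..b}. d dvd x}"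
      and "(\<lambda>x. x div d) ` {x \<in> {a + 1..b}. d dvd x} \<subseteq> {a div d + 1..b div d}"
      using assms by (force simp: add1_zle_eq)+
  qed (use assms in auto)
  from bij_betw_same_card[OF this] show ?thesis by simp
qed

text \<open>This is superadditivity of the floor function, applied to
  \<open>A = (A - C) + C\<close>.\<close>

lemma card_multiples_ge:
  fixes A C d :: int
  assumes "d > 0"
  shows "card {x \<in> {1..C}. d dvd x} \<le> card {x \<in> {A - C + 1..A}. d dvd x}"
proof -
  have "(A - C) div d + C div d \<le> A div d"
    using div_add1_eq[of "A - C" C d] assms by (simp add: pos_imp_zdiv_nonneg_iff)
  then show ?thesis
    using card_multiples[OF assms, of 0 C] card_multiples[OF assms, of "A - C" A] by simp
qed

text \<open>\<open>p^k\<close> divides the gcd iff it divides both coordinates, so after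
  interchanging the sums the count for each \<open>k\<close> factors into two one-dimensional
  counts.\<close>

lemma sum_multiplicity_gcd_box:
  fixes X Y :: "int set"
  assumes p: "prime p" and "finite X" "finite Y" and X: "X \<subseteq> {1..int K}" and Y: "Y \<subseteq> {1..}"
  shows "(\<Sum>s\<in>X \<times> Y. multiplicity (int p) (gcd (fst s) (snd s))) =
    (\<Sum>k = 1..K. card {x \<in> X. int p ^ k dvd x} * card {y \<in> Y. int p ^ k dvd y})"
proof -
  have m: "multiplicity (int p) (gcd x y) = (\<Sum>k = 1..K. of_bool (int p ^ k dvd x \<and> int p ^ k dvd y))"
    if "x \<in> X" "y \<in> Y" for x y
  proof -
    have "x > 0" "x \<le> int K" using that X Y by auto
    \<comment> \<open>The gcd is at most \<open>x\<close>, so the bound \<open>K\<close> on the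
      first side controls all gcds.\<close>
    then have "0 < gcd x y" "gcd x y \<le> int K"
      using zdvd_imp_le[OF gcd_dvd1, of x y] by (simp, linarith)
    from multiplicity_eq_card[OF p this] show ?thesis by (simp add: sum.inter_filter[symmetric] of_bool_def Int_def)
  qed
  have "(\<Sum>s\<in>X \<times> Y. multiplicity (int p) (gcd (fst s) (snd s))) =
      (\<Sum>(x, y)\<in>X \<times> Y. \<Sum>k = 1..K. of_bool (int p ^ k dvd x \<and> int p ^ k dvd y))"
    using m by (intro sum.cong) auto
  also have "\<dots> = (\<Sum>k = 1..K. \<Sum>(x, y)\<in>X \<times> Y. of_bool (int p ^ k dvd x) * of_bool (int p ^ k dvd y))"
    unfolding case_prod_beta of_bool_conj by (rule sum.swap)
  also have "\<dots> = (\<Sum>k = 1..K. (\<Sum>x\<in>X. of_bool (int p ^ k dvd x)) * (\<Sum>y\<in>Y. of_bool (int p ^ k dvd y)))"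
    by (simp only: sum_product sum.cartesian_product)
  also have "\<dots> = (\<Sum>k = 1..K. card {x \<in> X. int p ^ k dvd x} * card {y \<in> Y. int p ^ k dvd y})"
    using assms(2,3) by (simp add: Int_def)
  finally show ?thesis .
qed

section \<open>Integrality of quotients with denominator of norm prime to \<open>p\<close>\<close>

lemma padic_abs_Fract_le_1:
  assumes p: "prime p" and "\<not> int p dvd b"
  shows "padic_abs p (Fract a b) \<le> 1"
proof (cases "a = 0")
  case True
  then show ?thesis by (simp add: rat_number_collapse)
next
  case False
  have "b \<noteq> 0" using assms by auto
  then have "padic_val p (Fract a b) \<ge> 0"
    using False assms by (simp add: padic_val_Fract not_dvd_imp_multiplicity_0)
  then have "real p powi (- padic_val p (Fract a b)) \<le> real p powi 0"
    using prime_ge_1_nat[OF p] by (intro power_int_increasing) auto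
  then show ?thesis by (simp add: padic_abs_def)
qed

text \<open>Multiplying through by the conjugate \<open>u - iv\<close> gives both coordinates the
  denominator \<open>u^2 + v^2\<close>, which is prime to \<open>p\<close>.\<close>

lemma padic_of_gaussian_rational_quotient_mem:
  fixes a b u v :: int
  assumes p: "prime p" and nd: "\<not> int p dvd u\<^sup>2 + v\<^sup>2"
  shows "padic_of_gaussian_rational p ((of_int a + \<i> * of_int b) / (of_int u + \<i> * of_int v))
    \<in> padic_gaussian_integers p"
proof -
  let ?n = "u\<^sup>2 + v\<^sup>2"
  have n: "?n \<noteq> 0" using nd by (metis dvd_0_right)
  have "(of_int a + \<i> * of_int b) / (of_int u + \<i> * of_int v) =
      Complex (of_rat (Fract (a * u + b * v) ?n)) (of_rat (Fract (b * u - a * v) ?n))"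
    using n by (simp add: complex_eq_iff Re_divide Im_divide of_rat_rat)
  moreover have "padic_of_rat p (Fract c ?n) \<in> padic_integers p" for c
    using padic_abs_Fract_le_1[OF p nd] by (simp add: padic_of_rat_in_padic_integers_iff[OF p])
  moreover have "X \<in> carrier (padic_field p)" if "X \<in> padic_integers p" for X
    using that by (simp add: padic_integers_def)
  ultimately show ?thesis
    by (simp add: padic_of_gaussian_rational_Complex padic_gaussian_integers_def
        padic_gaussian_field_def adjoin_i_def)
qed

theorem lemma2p1:
  fixes p :: nat and A B C D :: int
  assumes "prime p" and "odd p" and "[p = 3] (mod 4)"
    and "A \<ge> C" and "C \<ge> 1" and "B \<ge> D" and "D \<ge> 1"
  shows "padic_of_gaussian_rational p (rect_gauss_binomial A B C D) \<in> padic_gaussian_integers p"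
proof -
  note p = assms(1,3)
  define M where "M X Y = (\<Sum>s\<in>X \<times> Y. multiplicity (int p) (gcd (fst s) (snd s)))"
    for X Y :: "int set"
  let ?N = "{A - C + 1..A} \<times> {B - D + 1..B}" and ?E = "{1..C} \<times> {1..D}"
  \<comment> \<open>From \<open>A >= C\<close> and \<open>B >= D\<close>, both sides of the
    numerator box start at 1 or later.\<close>
  have "(fst s, snd s) \<noteq> (0, 0)" if "s \<in> ?N" for s :: "int \<times> int"
    using that assms by auto
  with prod_gaussian_int_decompose[OF p, of ?N fst snd] obtain a b :: int where
    num: "(\<Prod>s\<in>?N. of_int (fst s) + \<i> * of_int (snd s)) =
      of_nat p ^ M {A - C + 1..A} {B - D + 1..B} * (of_int a + \<i> * of_int b)"
    unfolding M_def by blast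
  have "(fst s, snd s) \<noteq> (0, 0)" if "s \<in> ?E" for s :: "int \<times> int"
    using that by auto
  with prod_gaussian_int_decompose[OF p, of ?E fst snd] obtain u v :: int where
    den: "(\<Prod>s\<in>?E. of_int (fst s) + \<i> * of_int (snd s)) =
      of_nat p ^ M {1..C} {1..D} * (of_int u + \<i> * of_int v)" and nd: "\<not> int p dvd u\<^sup>2 + v\<^sup>2"
    unfolding M_def by blast
  have "M {1..C} {1..D} \<le> M {A - C + 1..A} {B - D + 1..B}"
  proof -
    have pos: "int p ^ k > 0" for k using prime_gt_0_nat[OF p(1)] by simp
    \<comment> \<open>As \<open>C <= A\<close>, the cutoff \<open>nat A\<close> serves both boxes,
      and the two sums can be compared term by term.\<close>
    have "M {1..C} {1..D} = (\<Sum>k = 1..nat A. card {x \<in> {1..C}. int p ^ k dvd x} *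
        card {y \<in> {1..D}. int p ^ k dvd y})"
      unfolding M_def
      using assms by (intro sum_multiplicity_gcd_box) auto
    also have "\<dots> \<le> (\<Sum>k = 1..nat A. card {x \<in> {A - C + 1..A}. int p ^ k dvd x} *
        card {y \<in> {B - D + 1..B}. int p ^ k dvd y})"
      using pos by (intro sum_mono mult_le_mono card_multiples_ge)
    also have "\<dots> = M {A - C + 1..A} {B - D + 1..B}"
      unfolding M_def
      using assms by (intro sum_multiplicity_gcd_box[symmetric]) auto
    finally show ?thesis .
  qed
  then obtain r where r: "M {A - C + 1..A} {B - D + 1..B} = M {1..C} {1..D} + r"
    using le_Suc_ex by blast
  have "rect_gauss_binomial A B C D =
      (\<Prod>s\<in>?N. of_int (fst s) + \<i> * of_int (snd s)) / (\<Prod>s\<in>?E. of_int (fst s) + \<i> * of_int (snd s))"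
    by (simp add: rect_gauss_binomial_alt prod.cartesian_product case_prod_beta)
  also have "\<dots> = of_nat p ^ r * (of_int a + \<i> * of_int b) / (of_int u + \<i> * of_int v)"
    unfolding num den r power_add using prime_gt_0_nat[OF p(1)] by simp
  \<comment> \<open>The surplus power of \<open>p\<close> goes into the numerator; the remaining
    denominator has norm prime to \<open>p\<close>.\<close>
  also have "\<dots> = (of_int (int p ^ r * a) + \<i> * of_int (int p ^ r * b)) / (of_int u + \<i> * of_int v)"
    by (simp add: algebra_simps)
  finally show ?thesis
    using padic_of_gaussian_rational_quotient_mem[OF p(1) nd] by (simp only:)
qed

end
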